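(* Let $T_0>0$ be a real number. If $$\sup_{i=1,\dots,d}\ \sum_{k\in\mathbf Z}\ \sup_{x,y\in\mathbf R^d}\left|\mathbf E_\nu\left[\widetilde F_i(x,\cdot)\cdot\widetilde F_i(y,T^k(\cdot))\right]\right|<+\infty,$$ then $$\sup_{x\in\mathbf R^d}\left\|\sup_{t\in[0,T_0]}|e_t^\varepsilon(x,\cdot)|_\infty\right\|_{L^2}=O(|\ln(\varepsilon)|\sqrt\varepsilon)\quad(\varepsilon\to0).$$
   Context: $(\Omega,\mathcal F,\nu,T)$ is an invertible probability dynamical system: $(\Omega,\mathcal F,\nu)$ is a probability space, $T:\Omega\to\Omega$ is measurable and $\nu$-preserving, and $T$ is one-to-one from a set $\Omega\setminus N_0$ onto a set $\Omega\setminus N_1$ with $\nu(N_0)=\nu(N_1)=0$, with measurable inverse $T^{-1}$. $\mathbf E_\nu$ is the expectation and $L^2$ the norm with respect to $\nu$. $d\ge1$ is an integer and $|\cdot|_\infty$ is the maximum norm on $\mathbf R^d$. $F:\mathbf R^d\times\Omega\to\mathbf R^d$ is measurable, uniformly bounded and uniformly Lipschitz continuous in the first parameter. $\bar F(x)=\int_\Omega F(x,\omega)\,d\nu(\omega)$, $\widetilde F(x,\omega)=F(x,\omega)-\bar F(x)$, with coordinates $\widetilde F_1,\dots,\widetilde F_d$. For $\varepsilon>0$ and $(x,\omega)\in\mathbf R^d\times\Omega$, $t\mapsto x_t^\varepsilon(x,\omega)$ ($t\ge0$) is the continuous solution of $\frac{dx_t^\varepsilon}{dt}(x,\omega)=F(x_t^\varepsilon(x,\omega),T^{\lfloor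 t/\varepsilon\rfloor}(\omega))$ for $t\notin\varepsilon\mathbf Z$, with $x_0^\varepsilon(x,\omega)=x$; $t\mapsto w_t(x)$ is the solution of $\frac{dw_t}{dt}(x)=\bar F(w_t(x))$, $w_0(x)=x$; and $e_t^\varepsilon(x,\omega)=x_t^\varepsilon(x,\omega)-w_t(x)$. *)

theory Defs
  imports "HOL-Probability.Probability"
begin

locale invertible_pds = prob_space M for M :: "'w measure" +
  fixes T :: "'w \<Rightarrow> 'w" and N0 N1 :: "'w set"
  assumes T_measurable: "T \<in> measurable M M"
    and T_preserving: "distr M M T = M"
    and N0_null: "N0 \<in> null_sets M"
    and N1_null: "N1 \<in> null_sets M"
    and T_bij: "bij_betw T (space M - N0) (space M - N1)"
    and T_inv_measurable: "the_inv_into (space M - N0) T \<in>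
          measurable (restrict_space M (space M - N1)) (restrict_space M (space M - N0))"

(* The inverse is only given outside N1. It is extended by the identity on the null set N1,
   which keeps it measurable on M and does not affect any integral. *)
definition pds_inv :: "'w measure \<Rightarrow> ('w \<Rightarrow> 'w) \<Rightarrow> 'w set \<Rightarrow> 'w set \<Rightarrow> 'w \<Rightarrow> 'w" where
  "pds_inv M T N0 N1 \<omega> =
     (if \<omega> \<in> space M - N1 then the_inv_into (space M - N0) T \<omega> else \<omega>)"

definition pds_iter ::
    "'w measure \<Rightarrow> ('w \<Rightarrow> 'w) \<Rightarrow> 'w set \<Rightarrow> 'w set \<Rightarrow> int \<Rightarrow> 'w \<Rightarrow> 'w" where
  "pds_iter M T N0 N1 k =
     (if 0 \<le> k then T ^^ nat k else pds_inv M T N0 N1 ^^ nat (- k))"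

definition mean_field :: "'w measure \<Rightarrow> ('x \<Rightarrow> 'w \<Rightarrow> real ^ 'd) \<Rightarrow> 'x \<Rightarrow> real ^ 'd" where
  "mean_field M F x = (\<integral>\<omega>. F x \<omega> \<partial>M)"

definition centred_field :: "'w measure \<Rightarrow> ('x \<Rightarrow> 'w \<Rightarrow> real ^ 'd) \<Rightarrow> 'x \<Rightarrow> 'w \<Rightarrow> real ^ 'd" where
  "centred_field M F x \<omega> = F x \<omega> - mean_field M F x"

definition perturbed_solution ::
    "('w \<Rightarrow> 'w) \<Rightarrow> (real ^ 'd \<Rightarrow> 'w \<Rightarrow> real ^ 'd) \<Rightarrow> real \<Rightarrow> real ^ 'd \<Rightarrow> 'w
       \<Rightarrow> (real \<Rightarrow> real ^ 'd) \<Rightarrow> bool" where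
  "perturbed_solution T F \<epsilon> x \<omega> \<xi> \<longleftrightarrow>
     continuous_on {0..} \<xi> \<and> \<xi> 0 = x \<and>
     (\<forall>t\<ge>0. t \<notin> {\<epsilon> * of_int k | k :: int. True} \<longrightarrow>
        (\<xi> has_vector_derivative F (\<xi> t) ((T ^^ nat \<lfloor>t / \<epsilon>\<rfloor>) \<omega>)) (at t))"

definition averaged_solution ::
    "(real ^ 'd \<Rightarrow> real ^ 'd) \<Rightarrow> real ^ 'd \<Rightarrow> (real \<Rightarrow> real ^ 'd) \<Rightarrow> bool" where
  "averaged_solution G x \<xi> \<longleftrightarrow>
     \<xi> 0 = x \<and> (\<forall>t\<ge>0. (\<xi> has_vector_derivative G (\<xi> t)) (at t within {0..}))"

(* Extended-valued, so that a finite bound on it includes square integrability;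
   ennreal has no square root, hence the case distinction. *)
definition L2_norm :: "'w measure \<Rightarrow> ('w \<Rightarrow> ennreal) \<Rightarrow> ennreal" where
  "L2_norm M f =
     (let I = (\<integral>\<^sup>+ \<omega>. (f \<omega>)\<^sup>2 \<partial>M) in if I = \<top> then \<top> else ennreal (sqrt (enn2real I)))"

end

theory Submission
  imports Defs
begin

text \<open>
  The averaged path \<open>w\<close> is deterministic, and this is what makes the estimate work. Write the
  vector field along \<open>x\<close> as its value along \<open>w\<close> plus a Lipschitz error. On the grid of times
  \<open>\<epsilon> * k\<close> both flows follow their Euler schemes up to \<open>O(\<epsilon>\<^sup>2)\<close> per step, so the discrete Gronwall
  inequality bounds the error, for each \<open>\<omega>\<close> separately, by a constant times \<open>\<epsilon>\<close> times
  \<open>1 + max\<^sub>m \<bar>S\<^sub>m\<bar>\<close>. Here \<open>S\<^sub>m\<close> is the sum over \<open>k < m\<close> of the centred field at the point \<open>w(\<epsilon> k)\<close> and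
  the state \<open>T\<^sup>k \<omega>\<close>. This is \<open>averaging_error_le\<close>.

  Because the points \<open>w(\<epsilon> k)\<close> do not depend on \<open>\<omega>\<close>, invariance of the measure reduces every
  covariance between two summands to one of the correlations in the hypothesis, whatever the points are.
  Their summability makes the summands quasi-orthogonal: a block of \<open>n\<close> consecutive summands
  has second moment \<open>O(n)\<close> (\<open>noise_second_moment_le\<close>).

  Quasi-orthogonality alone controls the maximum of the partial sums by the dyadic argument of
  Rademacher and Menshov, at the price of a logarithm: with \<open>2 ^ r\<close> summands the second moment of
  the maximum is \<open>O((r + 1)\<^sup>2 * 2 ^ r)\<close> (\<open>partial_sum_le_dyadic_energy\<close>, \<open>integral_dyadic_energy_le\<close>).
  For \<open>2 ^ r\<close> of order \<open>1 / \<epsilon>\<close> the \<open>L\<^sup>2\<close> norm of the maximum is \<open>O(\<bar>ln \<epsilon>\<bar> / sqrt \<epsilon>)\<close>, and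
  the prefactor \<open>\<epsilon>\<close> gives the claimed rate.
\<close>

section \<open>A maximal inequality for quasi-orthogonal sums\<close>

text \<open>
  This is the sum of the squared norms of the block sums of \<open>y\<close>, over all \<open>r + 1\<close> levels of the
  dyadic subdivision of the index interval \<open>{a..<a + 2 ^ r}\<close>.
\<close>

fun dyadic_energy :: "(nat \<Rightarrow> 'a::real_normed_vector) \<Rightarrow> nat \<Rightarrow> nat \<Rightarrow> real" where
  "dyadic_energy y a 0 = (norm (y a))\<^sup>2"
| "dyadic_energy y a (Suc r) = (norm (\<Sum>k=a..<a + 2 ^ Suc r. y k))\<^sup>2
     + dyadic_energy y a r + dyadic_energy y (a + 2 ^ r) r"

lemma dyadic_energy_nonneg: "0 \<le> dyadic_energy y a r"
  by (induction r arbitrary: a) auto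

lemma block_le_dyadic_energy: "(norm (\<Sum>k=a..<a + 2 ^ r. y k))\<^sup>2 \<le> dyadic_energy y a r"
  using dyadic_energy_nonneg by (cases r) (auto intro!: add_nonneg_nonneg)

text \<open>
  The binary expansion of \<open>m\<close> cuts the initial segment into at most one dyadic block per level, and
  the Cauchy-Schwarz inequality over the \<open>r + 1\<close> levels produces the factor. The right-hand side does
  not involve \<open>m\<close>, so one random variable dominates all partial sums at once.
\<close>

lemma partial_sum_le_dyadic_energy:
  assumes "m \<le> 2 ^ r"
  shows "(norm (\<Sum>k=a..<a + m. y k))\<^sup>2 \<le> (real r + 1) * dyadic_energy y a r"
  using assms
proof (induction r arbitrary: a m)
  case 0
  then have "m = 0 \<or> m = 1" by auto
  then show ?case by auto
next
  case (Suc r)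
  define Q where "Q = dyadic_energy y a r + dyadic_energy y (a + 2 ^ r) r"
  have nn: "0 \<le> dyadic_energy y a r" "0 \<le> dyadic_energy y (a + 2 ^ r) r"
    by (rule dyadic_energy_nonneg)+
  have "Q \<le> dyadic_energy y a (Suc r)"
    by (simp add: Q_def)
  then have Q: "(real r + 2) * Q \<le> (real (Suc r) + 1) * dyadic_energy y a (Suc r)"
    by (intro mult_mono) (auto simp: Q_def intro: add_nonneg_nonneg nn simp del: dyadic_energy.simps)
  have "(norm (\<Sum>k=a..<a + m. y k))\<^sup>2 \<le> (real r + 2) * Q"
  proof (cases "m \<le> 2 ^ r")
    case True
    have "(norm (\<Sum>k=a..<a + m. y k))\<^sup>2 \<le> (real r + 1) * dyadic_energy y a r"
      by (rule Suc.IH[OF True])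
    also have "\<dots> \<le> (real r + 2) * Q"
      using nn by (intro mult_mono) (auto simp: Q_def)
    finally show ?thesis .
  next
    case False
    define p where "p = norm (\<Sum>k=a..<a + 2 ^ r. y k)"
    define q where "q = norm (\<Sum>k=a + 2 ^ r..<(a + 2 ^ r) + (m - 2 ^ r). y k)"
    have q: "q\<^sup>2 \<le> (real r + 1) * dyadic_energy y (a + 2 ^ r) r"
      unfolding q_def by (rule Suc.IH) (use Suc.prems in auto)
    have p: "p\<^sup>2 \<le> dyadic_energy y a r"
      unfolding p_def by (rule block_le_dyadic_energy)
    have "(\<Sum>k=a..<a + m. y k)
        = (\<Sum>k=a..<a + 2 ^ r. y k) + (\<Sum>k=a + 2 ^ r..<(a + 2 ^ r) + (m - 2 ^ r). y k)"
      using False by (subst sum.atLeastLessThan_concat) auto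
    then have "norm (\<Sum>k=a..<a + m. y k) \<le> p + q"
      by (simp add: p_def q_def norm_triangle_ineq)
    then have "(norm (\<Sum>k=a..<a + m. y k))\<^sup>2 \<le> (p + q)\<^sup>2"
      by (simp add: power_mono)
    \<comment> \<open>Cauchy-Schwarz with weights \<open>1\<close> for the full left half and \<open>r + 1\<close> for the remainder, which
      matches the factor supplied by the induction hypothesis.\<close>
    also have "\<dots> \<le> (real r + 2) * (p\<^sup>2 + q\<^sup>2 / (real r + 1))"
    proof -
      define c where "c = real r + 1"
      have c: "c > 0" by (simp add: c_def)
      define d where "d = q / c"
      have q_eq: "q = c * d" using c by (simp add: d_def)
      have "(c + 1) * (p\<^sup>2 + c * d\<^sup>2) - (p + c * d)\<^sup>2 = c * (p - d)\<^sup>2"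
        by algebra
      moreover have "0 \<le> c * (p - d)\<^sup>2" using c by simp
      moreover have "q\<^sup>2 / c = c * d\<^sup>2"
        using c by (simp add: q_eq power2_eq_square)
      ultimately have "(p + q)\<^sup>2 \<le> (c + 1) * (p\<^sup>2 + q\<^sup>2 / c)" by (simp add: q_eq)
      moreover have "c + 1 = real r + 2" by (simp add: c_def)
      ultimately show ?thesis unfolding c_def by metis
    qed
    also have "\<dots> \<le> (real r + 2) * Q"
    proof -
      have "q\<^sup>2 / (real r + 1) \<le> dyadic_energy y (a + 2 ^ r) r"
        using q by (simp add: divide_le_eq mult.commute)
      then show ?thesis using p by (intro mult_left_mono) (auto simp: Q_def)
    qed
    finally show ?thesis .
  qed
  with Q show ?case by linarith
qed

text \<open>Each of the \<open>r + 1\<close> levels partitions \<open>2 ^ r\<close> indices and so contributes at most \<open>2 ^ r * K\<close>.\<close>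

lemma integral_dyadic_energy_le:
  assumes int: "\<And>a b. integrable M (\<lambda>\<omega>. (norm (\<Sum>k=a..<b. Y k \<omega>))\<^sup>2)"
    and le: "\<And>a n. (\<integral>\<omega>. (norm (\<Sum>k=a..<a + n. Y k \<omega>))\<^sup>2 \<partial>M) \<le> K * real n"
  shows "integrable M (\<lambda>\<omega>. dyadic_energy (\<lambda>k. Y k \<omega>) a r)
    \<and> (\<integral>\<omega>. dyadic_energy (\<lambda>k. Y k \<omega>) a r \<partial>M) \<le> (real r + 1) * 2 ^ r * K"
proof (induction r arbitrary: a)
  case 0
  show ?case using int[of a "Suc a"] le[of a 1] by simp
next
  case (Suc r)
  let ?E = "\<lambda>a r \<omega>. dyadic_energy (\<lambda>k. Y k \<omega>) a r"
  let ?S = "\<lambda>\<omega>. (norm (\<Sum>k=a..<a + 2 ^ Suc r. Y k \<omega>))\<^sup>2"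
  have I: "integrable M ?S" "integrable M (?E a r)" "integrable M (?E (a + 2 ^ r) r)"
    using int[of a "a + 2 ^ Suc r"] Suc[of a] Suc[of "a + 2 ^ r"] by simp_all
  have J: "(\<integral>\<omega>. ?S \<omega> \<partial>M) \<le> K * real (2 ^ Suc r)"
      "(\<integral>\<omega>. ?E a r \<omega> \<partial>M) \<le> (real r + 1) * 2 ^ r * K"
      "(\<integral>\<omega>. ?E (a + 2 ^ r) r \<omega> \<partial>M) \<le> (real r + 1) * 2 ^ r * K"
    using le[of a "2 ^ Suc r"] Suc[of a] Suc[of "a + 2 ^ r"] by simp_all
  have "integrable M (?E a (Suc r))"
    unfolding dyadic_energy.simps
    by (rule Bochner_Integration.integrable_add[OF Bochner_Integration.integrable_add[OF I(1,2)] I(3)])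
  moreover have "(\<integral>\<omega>. ?E a (Suc r) \<omega> \<partial>M)
      = (\<integral>\<omega>. ?S \<omega> \<partial>M) + (\<integral>\<omega>. ?E a r \<omega> \<partial>M) + (\<integral>\<omega>. ?E (a + 2 ^ r) r \<omega> \<partial>M)"
    unfolding dyadic_energy.simps
    by (simp only: Bochner_Integration.integral_add[OF Bochner_Integration.integrable_add[OF I(1,2)] I(3)]
          Bochner_Integration.integral_add[OF I(1,2)])
  moreover have "K * real (2 ^ Suc r) + (real r + 1) * 2 ^ r * K + (real r + 1) * 2 ^ r * K
      = (real (Suc r) + 1) * 2 ^ Suc r * K"
  proof -
    have "K * (2 * P) + (x + 1) * P * K + (x + 1) * P * K = (x + 1 + 1) * (2 * P) * K" for P x :: real
      by algebra
    from this[of "2 ^ r" "real r"] show ?thesis by (simp add: add.commute)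
  qed
  moreover note J
  ultimately show ?case
    by (intro conjI) (assumption, (linarith))
qed

text \<open>
  In the covariance matrix every row sums to at most \<open>2 * C\<close>, one \<open>C\<close> for each side of the diagonal.
\<close>

lemma (in prob_space) second_moment_sum_le:
  fixes Y :: "nat \<Rightarrow> 'a \<Rightarrow> real"
  assumes meas: "\<And>k. Y k \<in> borel_measurable M"
    and bdd: "\<And>k \<omega>. \<omega> \<in> space M \<Longrightarrow> \<bar>Y k \<omega>\<bar> \<le> B"
    and corr: "\<And>k l. k \<le> l \<Longrightarrow> expectation (\<lambda>\<omega>. Y k \<omega> * Y l \<omega>) \<le> c (l - k)"
    and c_nonneg: "\<And>j. 0 \<le> c j"
    and c_sum: "\<And>n. (\<Sum>j<n. c j) \<le> C"
  shows "expectation (\<lambda>\<omega>. (\<Sum>k=a..<a + n. Y k \<omega>)\<^sup>2) \<le> 2 * C * real n"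
proof -
  have int: "integrable M (\<lambda>\<omega>. Y k \<omega> * Y l \<omega>)" for k l
  proof (rule integrable_const_bound[where B="B * B"])
    show "AE \<omega> in M. norm (Y k \<omega> * Y l \<omega>) \<le> B * B"
    proof (rule AE_I2)
      fix \<omega> assume "\<omega> \<in> space M"
      then have "\<bar>Y k \<omega>\<bar> \<le> B" "\<bar>Y l \<omega>\<bar> \<le> B" using bdd by auto
      then show "norm (Y k \<omega> * Y l \<omega>) \<le> B * B"
        by (auto simp: abs_mult intro!: mult_mono)
    qed
  qed (use meas in measurable)
  define c' where "c' k l = (if k \<le> l then c (l - k) else c (k - l))" for k l
  have corr': "expectation (\<lambda>\<omega>. Y k \<omega> * Y l \<omega>) \<le> c' k l" for k l
    using corr[of k l] corr[of l k] by (auto simp: c'_def mult.commute)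
  have row: "(\<Sum>l=a..<a + n. c' k l) \<le> 2 * C" if "k \<in> {a..<a + n}" for k
  proof -
    have reindex: "(\<Sum>l\<in>A. c (h l)) \<le> C" if "finite A" "inj_on h A" for A h
    proof -
      have "(\<Sum>l\<in>A. c (h l)) = (\<Sum>j\<in>h ` A. c j)"
        using that by (simp add: sum.reindex)
      also have "\<dots> \<le> (\<Sum>j<Suc (Max (h ` A)). c j)"
        using that c_nonneg by (intro sum_mono2) (auto simp: less_Suc_eq_le)
      also have "\<dots> \<le> C" by (rule c_sum)
      finally show ?thesis .
    qed
    have "(\<Sum>l=a..<a + n. c' k l) = (\<Sum>l=a..<k. c' k l) + (\<Sum>l=k..<a + n. c' k l)"
      using that by (subst sum.atLeastLessThan_concat) auto
    also have "(\<Sum>l=a..<k. c' k l) = (\<Sum>l=a..<k. c (k - l))"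
      by (intro sum.cong) (auto simp: c'_def)
    also have "(\<Sum>l=k..<a + n. c' k l) = (\<Sum>l=k..<a + n. c (l - k))"
      by (intro sum.cong) (auto simp: c'_def)
    also have "(\<Sum>l=a..<k. c (k - l)) \<le> C"
      by (intro reindex) (auto simp: inj_on_def)
    also have "(\<Sum>l=k..<a + n. c (l - k)) \<le> C"
      by (intro reindex) (auto simp: inj_on_def)
    finally show ?thesis by simp
  qed
  have "expectation (\<lambda>\<omega>. (\<Sum>k=a..<a + n. Y k \<omega>)\<^sup>2)
      = expectation (\<lambda>\<omega>. \<Sum>k=a..<a + n. \<Sum>l=a..<a + n. Y k \<omega> * Y l \<omega>)"
    by (simp add: power2_eq_square sum_product)
  also have "\<dots> = (\<Sum>k=a..<a + n. \<Sum>l=a..<a + n. expectation (\<lambda>\<omega>. Y k \<omega> * Y l \<omega>))"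
    by (simp add: int)
  also have "\<dots> \<le> (\<Sum>k=a..<a + n. \<Sum>l=a..<a + n. c' k l)"
    by (intro sum_mono corr')
  also have "\<dots> \<le> (\<Sum>k=a..<a + n. 2 * C)"
    by (intro sum_mono row)
  finally show ?thesis by (simp add: mult.commute)
qed

section \<open>Pathwise comparison of the two flows\<close>

text \<open>
  Speed at most \<open>B\<close> keeps the path within \<open>B * (u - s)\<close> of its starting point, hence its velocity
  within \<open>L * B * (u - s)\<close> of the initial one; this gives the one-step error of the Euler scheme. The
  derivative is required on the open interval only, since the perturbed path has corners at the
  grid times.
\<close>

lemma flow_increment_bounds:
  fixes \<xi> :: "real \<Rightarrow> 'a::real_normed_vector"
  assumes cont: "continuous_on {s..u} \<xi>" and "s \<le> u"
    and deriv: "\<And>t. s < t \<Longrightarrow> t < u \<Longrightarrow> (\<xi> has_vector_derivative g (\<xi> t)) (at t)"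
    and lip: "L-lipschitz_on UNIV g" and bdd: "\<And>z. norm (g z) \<le> B"
  shows "norm (\<xi> u - \<xi> s) \<le> B * (u - s)"
    and "norm (\<xi> u - \<xi> s - (u - s) *\<^sub>R g (\<xi> s)) \<le> L * B * (u - s)\<^sup>2"
proof -
  have speed: "norm (\<xi> v - \<xi> s) \<le> B * (v - s)" if v: "s \<le> v" "v \<le> u" for v
  proof (cases "s = v")
    case False
    then have "norm (\<xi> v - \<xi> s) \<le> B * v - B * s"
      using v deriv bdd
      by (intro differentiable_bound_general[where f'="\<lambda>t. g (\<xi> t)" and \<phi>'="\<lambda>_. B"]
            continuous_on_subset[OF cont])
         (auto intro!: continuous_intros derivative_eq_intros simp flip: has_real_derivative_iff_has_vector_derivative)
    then show ?thesis by (simp add: algebra_simps)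
  qed auto
  show "norm (\<xi> u - \<xi> s) \<le> B * (u - s)" using speed[of u] \<open>s \<le> u\<close> by simp
  have L: "0 \<le> L" using lip by (rule lipschitz_on_nonneg)
  have B: "0 \<le> B" using bdd[of 0] norm_ge_zero order_trans by blast
  show "norm (\<xi> u - \<xi> s - (u - s) *\<^sub>R g (\<xi> s)) \<le> L * B * (u - s)\<^sup>2"
  proof (cases "s = u")
    case False
    define \<psi> where "\<psi> t = \<xi> t - t *\<^sub>R g (\<xi> s)" for t
    have "norm (g (\<xi> t) - g (\<xi> s)) \<le> L * B * (u - s)" if t: "s < t" "t < u" for t
    proof -
      have "norm (g (\<xi> t) - g (\<xi> s)) \<le> L * norm (\<xi> t - \<xi> s)"
        using lipschitz_onD[OF lip, of "\<xi> t" "\<xi> s"] by (simp add: dist_norm)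
      also have "\<dots> \<le> L * (B * (u - s))"
      proof (rule mult_left_mono[OF _ L])
        have "B * (t - s) \<le> B * (u - s)"
          using t B by (intro mult_left_mono) auto
        then show "norm (\<xi> t - \<xi> s) \<le> B * (u - s)"
          using speed[of t] t by linarith
      qed
      finally show ?thesis by (simp add: mult.assoc)
    qed
    then have "norm (\<psi> u - \<psi> s) \<le> L * B * (u - s) * u - L * B * (u - s) * s"
      using False \<open>s \<le> u\<close> deriv unfolding \<psi>_def
      by (intro differentiable_bound_general[where f'="\<lambda>t. g (\<xi> t) - g (\<xi> s)"
              and \<phi>'="\<lambda>_. L * B * (u - s)"])
         (auto intro!: continuous_intros derivative_eq_intros cont
               simp flip: has_real_derivative_iff_has_vector_derivative)
    moreover have "\<psi> u - \<psi> s = \<xi> u - \<xi> s - (u - s) *\<^sub>R g (\<xi> s)"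
      by (simp add: \<psi>_def algebra_simps)
    ultimately show ?thesis by (simp add: algebra_simps power2_eq_square)
  qed auto
qed

lemma discrete_gronwall:
  fixes u :: "nat \<Rightarrow> real"
  assumes "\<And>m. m \<le> n \<Longrightarrow> u m \<le> G + h * (\<Sum>k<m. u k)" and "0 \<le> h" and "m \<le> n"
  shows "u m \<le> G * (1 + h) ^ m"
  using \<open>m \<le> n\<close>
proof (induction m rule: less_induct)
  case (less m)
  have geo: "h * (\<Sum>k<m. (1 + h) ^ k) = (1 + h) ^ m - 1" for m
    by (induction m) (auto simp: algebra_simps)
  have "u m \<le> G + h * (\<Sum>k<m. u k)" using assms less.prems by blast
  also have "\<dots> \<le> G + h * (\<Sum>k<m. G * (1 + h) ^ k)"
    using less \<open>0 \<le> h\<close> by (intro add_left_mono mult_left_mono sum_mono) auto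
  also have "\<dots> = G + G * (h * (\<Sum>k<m. (1 + h) ^ k))"
    by (simp add: sum_distrib_left mult_ac)
  also have "\<dots> = G * (1 + h) ^ m"
    unfolding geo by (simp add: algebra_simps)
  finally show ?case .
qed

text \<open>
  The difference of the two velocities is split at the point \<open>\<eta>\<close> of the averaged path: the Lipschitz
  part feeds the Gronwall inequality, while the rest, \<open>f k - g\<close> evaluated along \<open>\<eta>\<close>, no longer
  involves \<open>\<xi>\<close> and enters only through its partial sums, so that its cancellations are kept.
\<close>

lemma averaging_error_le:
  fixes \<xi> \<eta> :: "real \<Rightarrow> 'a::real_normed_vector"
  assumes \<epsilon>: "0 < \<epsilon>"
    and \<xi>: "continuous_on {0..} \<xi>"
      "\<And>k t. \<epsilon> * real k < t \<Longrightarrow> t < \<epsilon> * real (Suc k) \<Longrightarrow>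
         (\<xi> has_vector_derivative f k (\<xi> t)) (at t)"
    and \<eta>: "continuous_on {0..} \<eta>"
      "\<And>t. 0 < t \<Longrightarrow> (\<eta> has_vector_derivative g (\<eta> t)) (at t)"
    and start: "\<xi> 0 = \<eta> 0"
    and lip: "\<And>k. L-lipschitz_on UNIV (f k)" "L-lipschitz_on UNIV g"
    and bdd: "\<And>k z. norm (f k z) \<le> B" "\<And>z. norm (g z) \<le> B"
    and G: "\<And>m. \<epsilon> * real m \<le> T \<Longrightarrow>
         norm (\<Sum>k<m. f k (\<eta> (\<epsilon> * real k)) - g (\<eta> (\<epsilon> * real k))) \<le> G"
    and t: "0 \<le> t" "t \<le> T"
  shows "norm (\<xi> t - \<eta> t) \<le> exp (L * T) * (\<epsilon> * G + 2 * L * B * T * \<epsilon>) + 2 * B * \<epsilon>"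
proof -
  define e where "e k = \<xi> (\<epsilon> * real k) - \<eta> (\<epsilon> * real k)" for k
  have L: "0 \<le> L" using lip(2) by (rule lipschitz_on_nonneg)
  have B: "0 \<le> B" using bdd(2)[of 0] norm_ge_zero order_trans by blast
  have grid: "0 \<le> \<epsilon> * real k" for k using \<epsilon> by simp
  have G0: "0 \<le> G" using G[of 0] t by simp
  note inc_\<xi> = flow_increment_bounds[OF continuous_on_subset[OF \<xi>(1)] _ \<xi>(2) lip(1) bdd(1)]
  note inc_\<eta> = flow_increment_bounds[OF continuous_on_subset[OF \<eta>(1)] _ \<eta>(2) lip(2) bdd(2)]
  define n where "n = nat \<lfloor>T / \<epsilon>\<rfloor>"
  have n: "\<epsilon> * real m \<le> T \<longleftrightarrow> m \<le> n" for m
    using t \<epsilon> by (simp add: n_def le_nat_iff le_floor_iff field_simps)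
  have step: "norm (e (Suc k) - e k - \<epsilon> *\<^sub>R (f k (\<eta> (\<epsilon> * real k)) - g (\<eta> (\<epsilon> * real k))))
      \<le> 2 * L * B * \<epsilon>\<^sup>2 + \<epsilon> * L * norm (e k)" for k
  proof -
    let ?s = "\<epsilon> * real k" and ?u = "\<epsilon> * real (Suc k)"
    have su: "?s \<le> ?u" "{?s..?u} \<subseteq> {0..}" "?u - ?s = \<epsilon>"
      using \<epsilon> grid[of k] by (auto simp: algebra_simps intro: order_trans)
    have a: "norm (\<xi> ?u - \<xi> ?s - \<epsilon> *\<^sub>R f k (\<xi> ?s)) \<le> L * B * \<epsilon>\<^sup>2"
      using inc_\<xi>(2)[OF su(2,1)] unfolding su(3) by blast
    have b: "norm (\<eta> ?u - \<eta> ?s - \<epsilon> *\<^sub>R g (\<eta> ?s)) \<le> L * B * \<epsilon>\<^sup>2"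
      using inc_\<eta>(2)[OF su(2,1)] grid[of k] unfolding su(3) by force
    have c: "norm (\<epsilon> *\<^sub>R (f k (\<xi> ?s) - f k (\<eta> ?s))) \<le> \<epsilon> * L * norm (e k)"
      using lipschitz_onD[OF lip(1), of "\<xi> ?s" "\<eta> ?s"] \<epsilon> by (simp add: e_def dist_norm mult.assoc)
    have split: "e (Suc k) - e k - \<epsilon> *\<^sub>R (f k (\<eta> ?s) - g (\<eta> ?s))
        = (\<xi> ?u - \<xi> ?s - \<epsilon> *\<^sub>R f k (\<xi> ?s)) - (\<eta> ?u - \<eta> ?s - \<epsilon> *\<^sub>R g (\<eta> ?s))
          + \<epsilon> *\<^sub>R (f k (\<xi> ?s) - f k (\<eta> ?s))"
      by (simp add: e_def algebra_simps)
    have "norm (e (Suc k) - e k - \<epsilon> *\<^sub>R (f k (\<eta> ?s) - g (\<eta> ?s)))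
        \<le> norm (\<xi> ?u - \<xi> ?s - \<epsilon> *\<^sub>R f k (\<xi> ?s)) + norm (\<eta> ?u - \<eta> ?s - \<epsilon> *\<^sub>R g (\<eta> ?s))
          + norm (\<epsilon> *\<^sub>R (f k (\<xi> ?s) - f k (\<eta> ?s)))"
      unfolding split
      by (rule order_trans[OF norm_triangle_ineq add_right_mono[OF norm_triangle_ineq4]])
    also have "\<dots> \<le> L * B * \<epsilon>\<^sup>2 + L * B * \<epsilon>\<^sup>2 + \<epsilon> * L * norm (e k)"
      by (rule add_mono[OF add_mono[OF a b] c])
    also have "\<dots> = 2 * L * B * \<epsilon>\<^sup>2 + \<epsilon> * L * norm (e k)" by simp
    finally show ?thesis .
  qed
  have rec: "norm (e m) \<le> (\<epsilon> * G + 2 * L * B * T * \<epsilon>) + \<epsilon> * L * (\<Sum>k<m. norm (e k))"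
    if m: "m \<le> n" for m
  proof -
    let ?d = "\<lambda>k. f k (\<eta> (\<epsilon> * real k)) - g (\<eta> (\<epsilon> * real k))"
    have "(\<Sum>k<m. e (Suc k) - e k - \<epsilon> *\<^sub>R ?d k) = (\<Sum>k<m. e (Suc k) - e k) - (\<Sum>k<m. \<epsilon> *\<^sub>R ?d k)"
      by (rule sum_subtractf)
    also have "(\<Sum>k<m. e (Suc k) - e k) = e m"
      by (simp add: sum_lessThan_telescope) (simp add: e_def start)
    also have "(\<Sum>k<m. \<epsilon> *\<^sub>R ?d k) = \<epsilon> *\<^sub>R (\<Sum>k<m. ?d k)"
      by (rule scaleR_sum_right[symmetric])
    finally have split: "e m = \<epsilon> *\<^sub>R (\<Sum>k<m. ?d k) + (\<Sum>k<m. e (Suc k) - e k - \<epsilon> *\<^sub>R ?d k)"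
      by (simp only: add_diff_eq add_diff_cancel_left')
    have noise: "norm (\<epsilon> *\<^sub>R (\<Sum>k<m. ?d k)) \<le> \<epsilon> * G"
      using G[of m] m n \<epsilon> by simp
    have "norm (\<Sum>k<m. e (Suc k) - e k - \<epsilon> *\<^sub>R ?d k)
        \<le> (\<Sum>k<m. 2 * L * B * \<epsilon>\<^sup>2 + \<epsilon> * L * norm (e k))"
      by (rule sum_norm_le) (rule step)
    also have "\<dots> = 2 * L * B * \<epsilon> * (\<epsilon> * real m) + \<epsilon> * L * (\<Sum>k<m. norm (e k))"
      by (simp add: sum.distrib sum_distrib_left power2_eq_square)
    also have "\<dots> \<le> 2 * L * B * \<epsilon> * T + \<epsilon> * L * (\<Sum>k<m. norm (e k))"
      using n[of m] m L B \<epsilon> by (intro add_right_mono mult_left_mono) auto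
    also have "2 * L * B * \<epsilon> * T = 2 * L * B * T * \<epsilon>" by simp
    finally have "norm (\<Sum>k<m. e (Suc k) - e k - \<epsilon> *\<^sub>R ?d k)
        \<le> 2 * L * B * T * \<epsilon> + \<epsilon> * L * (\<Sum>k<m. norm (e k))" .
    with noise show ?thesis
      unfolding split add.assoc by (rule norm_triangle_le[OF add_mono])
  qed
  define k where "k = nat \<lfloor>t / \<epsilon>\<rfloor>"
  have k: "\<epsilon> * real k \<le> t" "t < \<epsilon> * real (Suc k)"
  proof -
    have "real k = of_int \<lfloor>t / \<epsilon>\<rfloor>" using t \<epsilon> by (simp add: k_def)
    then have "real k \<le> t / \<epsilon>" "t / \<epsilon> < real (Suc k)" by linarith+
    then show "\<epsilon> * real k \<le> t" "t < \<epsilon> * real (Suc k)"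
      using \<epsilon> by (simp_all add: field_simps)
  qed
  have "k \<le> n" using k(1) t n[of k] by linarith
  then have "norm (e k) \<le> (\<epsilon> * G + 2 * L * B * T * \<epsilon>) * (1 + \<epsilon> * L) ^ k"
    using discrete_gronwall[OF rec] \<epsilon> L by simp
  also have "\<dots> \<le> (\<epsilon> * G + 2 * L * B * T * \<epsilon>) * exp (L * T)"
  proof (rule mult_left_mono)
    have "(1 + \<epsilon> * L) ^ k \<le> exp (\<epsilon> * L) ^ k"
      using \<epsilon> L by (intro power_mono exp_ge_add_one_self) auto
    also have "\<dots> = exp (L * (\<epsilon> * real k))"
      by (simp add: exp_of_nat_mult[symmetric] mult_ac)
    also have "\<dots> \<le> exp (L * T)"
      using L n[of k] \<open>k \<le> n\<close> by (simp add: mult_left_mono)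
    finally show "(1 + \<epsilon> * L) ^ k \<le> exp (L * T)" .
  qed (use \<epsilon> G0 L B t in auto)
  finally have ek: "norm (e k) \<le> (\<epsilon> * G + 2 * L * B * T * \<epsilon>) * exp (L * T)" .
  have sub: "{\<epsilon> * real k..t} \<subseteq> {0..}" using grid[of k] by auto
  have "B * (t - \<epsilon> * real k) \<le> B * \<epsilon>"
    using k(2) B by (intro mult_left_mono) (auto simp: algebra_simps)
  moreover have "norm (\<xi> t - \<xi> (\<epsilon> * real k)) \<le> B * (t - \<epsilon> * real k)"
    using inc_\<xi>(1)[OF sub k(1)] k(2) by force
  moreover have "norm (\<eta> t - \<eta> (\<epsilon> * real k)) \<le> B * (t - \<epsilon> * real k)"
    using inc_\<eta>(1)[OF sub k(1)] grid[of k] by force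
  moreover have "norm (\<xi> t - \<eta> t) \<le> norm (e k)
      + norm (\<xi> t - \<xi> (\<epsilon> * real k)) + norm (\<eta> t - \<eta> (\<epsilon> * real k))"
  proof -
    have "\<xi> t - \<eta> t = e k + (\<xi> t - \<xi> (\<epsilon> * real k)) - (\<eta> t - \<eta> (\<epsilon> * real k))"
      by (simp add: e_def)
    then show ?thesis
      by (metis add_right_mono norm_triangle_ineq norm_triangle_ineq4 order_trans)
  qed
  ultimately have "norm (\<xi> t - \<eta> t) \<le> norm (e k) + 2 * (B * \<epsilon>)"
    by linarith
  with ek show ?thesis
    by (simp add: mult.commute[of _ "exp (L * T)"])
qed

section \<open>Second moments of the noise along a deterministic sequence\<close>

context invertible_pds
begin

lemma iterate_measurable [measurable]: "T ^^ k \<in> measurable M M"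
  by (induction k) (auto intro: measurable_compose[OF _ T_measurable])

lemma distr_iterate: "distr M M (T ^^ k) = M"
proof (induction k)
  case 0
  then show ?case using distr_id[of M] by (simp add: id_def)
next
  case (Suc k)
  have "distr M M (T ^^ Suc k) = distr (distr M M (T ^^ k)) M T"
    unfolding funpow.simps by (rule distr_distr[symmetric]) (rule T_measurable iterate_measurable)+
  then show ?case unfolding Suc T_preserving .
qed

lemma correlation_shift:
  fixes f g :: "'w \<Rightarrow> real"
  assumes [measurable]: "f \<in> borel_measurable M" "g \<in> borel_measurable M" and "k \<le> l"
  shows "expectation (\<lambda>\<omega>. f ((T ^^ k) \<omega>) * g ((T ^^ l) \<omega>))
       = expectation (\<lambda>\<omega>. f \<omega> * g ((T ^^ (l - k)) \<omega>))"
proof -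
  have "(T ^^ l) \<omega> = (T ^^ (l - k)) ((T ^^ k) \<omega>)" for \<omega>
    using \<open>k \<le> l\<close> funpow_add[of "l - k" k T] by simp
  then have "expectation (\<lambda>\<omega>. f ((T ^^ k) \<omega>) * g ((T ^^ l) \<omega>))
      = integral\<^sup>L (distr M M (T ^^ k)) (\<lambda>\<omega>. f \<omega> * g ((T ^^ (l - k)) \<omega>))"
    by (subst integral_distr) auto
  then show ?thesis by (simp add: distr_iterate)
qed

end

context prob_space
begin

lemma integrable_bounded_field:
  fixes h :: "'a \<Rightarrow> 'b::{banach, second_countable_topology}"
  assumes "h \<in> borel_measurable M" "\<And>\<omega>. \<omega> \<in> space M \<Longrightarrow> norm (h \<omega>) \<le> B"
  shows "integrable M h"
  using assms by (intro integrable_const_bound[where B=B]) auto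

lemma norm_mean_le:
  fixes h :: "'a \<Rightarrow> 'b::{banach, second_countable_topology}"
  assumes "integrable M h" "\<And>\<omega>. \<omega> \<in> space M \<Longrightarrow> norm (h \<omega>) \<le> B"
  shows "norm (integral\<^sup>L M h) \<le> B"
proof -
  have "norm (integral\<^sup>L M h) \<le> (\<integral>\<omega>. norm (h \<omega>) \<partial>M)"
    by (rule integral_norm_bound)
  also have "\<dots> \<le> (\<integral>\<omega>. B \<partial>M)"
    using assms by (intro integral_mono) auto
  finally show ?thesis by (simp add: prob_space)
qed

lemma mean_field_lipschitz:
  fixes F :: "real ^ 'd \<Rightarrow> 'a \<Rightarrow> real ^ 'd"
  assumes int: "\<And>x. integrable M (F x)"
    and lip: "\<And>\<omega>. \<omega> \<in> space M \<Longrightarrow> L-lipschitz_on UNIV (\<lambda>x. F x \<omega>)"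
  shows "L-lipschitz_on UNIV (mean_field M F)"
proof (rule lipschitz_onI)
  obtain \<omega> where "\<omega> \<in> space M" using not_empty by blast
  then show "0 \<le> L" using lip lipschitz_on_nonneg by blast
  fix x y
  have "dist (mean_field M F x) (mean_field M F y) = norm (\<integral>\<omega>. F x \<omega> - F y \<omega> \<partial>M)"
    by (simp add: mean_field_def dist_norm int)
  also have "\<dots> \<le> L * dist x y"
    using lipschitz_onD[OF lip] int by (intro norm_mean_le) (auto simp: dist_norm)
  finally show "dist (mean_field M F x) (mean_field M F y) \<le> L * dist x y" .
qed

end

lemma norm_sq_eq_sum_component_sq: "(norm (v :: real ^ 'd))\<^sup>2 = (\<Sum>i\<in>UNIV. (v $ i)\<^sup>2)"
  by (simp add: norm_vec_def L2_set_def sum_nonneg)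

text \<open>
  The correlation bound is uniform in the two points \<open>x\<close> and \<open>y\<close>, which lets the field be evaluated
  at a different point \<open>p k\<close> for every \<open>k\<close>: stationarity of \<open>T\<close> still reduces each covariance to
  one with lag \<open>l - k\<close>. The coordinates are treated separately.
\<close>

lemma (in invertible_pds) noise_second_moment_le:
  fixes F :: "real ^ 'd \<Rightarrow> 'w \<Rightarrow> real ^ 'd" and p :: "nat \<Rightarrow> real ^ 'd"
  assumes meas: "\<And>x. F x \<in> borel_measurable M"
    and bdd: "\<And>x \<omega>. \<omega> \<in> space M \<Longrightarrow> norm (F x \<omega>) \<le> B"
    and corr: "\<And>i j x y. expectation (\<lambda>\<omega>. centred_field M F x \<omega> $ i
                 * centred_field M F y ((T ^^ j) \<omega>) $ i) \<le> c i j"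
    and c_nonneg: "\<And>i j. 0 \<le> c i j"
    and c_sum: "\<And>i n. (\<Sum>j<n. c i j) \<le> C"
  defines "Y \<equiv> \<lambda>k \<omega>. centred_field M F (p k) ((T ^^ k) \<omega>)"
  shows "integrable M (\<lambda>\<omega>. (norm (\<Sum>k=a..<b. Y k \<omega>))\<^sup>2)"
    and "expectation (\<lambda>\<omega>. (norm (\<Sum>k=a..<a + n. Y k \<omega>))\<^sup>2) \<le> 2 * C * real CARD('d) * real n"
proof -
  have cmeas [measurable]: "centred_field M F x \<in> borel_measurable M" for x
    using meas[of x] unfolding centred_field_def[abs_def] by measurable
  have Ymeas [measurable]: "Y k \<in> borel_measurable M" for k
    unfolding Y_def by measurable
  have Yicmeas [measurable]: "(\<lambda>\<omega>. Y k \<omega> $ i) \<in> borel_measurable M" for k i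
    by (rule borel_measurable_continuous_on[OF _ Ymeas]) (auto intro: continuous_intros)
  have cmeas_i [measurable]: "(\<lambda>\<omega>. centred_field M F x \<omega> $ i) \<in> borel_measurable M" for x i
    by (rule borel_measurable_continuous_on[OF _ cmeas]) (auto intro: continuous_intros)
  have "norm (mean_field M F x) \<le> B" for x
    unfolding mean_field_def using meas bdd by (intro norm_mean_le integrable_bounded_field) auto
  then have "norm (centred_field M F x \<omega>) \<le> 2 * B" if "\<omega> \<in> space M" for x \<omega>
    unfolding centred_field_def mult_2
    by (rule norm_triangle_le_diff[OF add_mono[OF bdd[OF that]]])
  then have Ybdd: "norm (Y k \<omega>) \<le> 2 * B" if "\<omega> \<in> space M" for k \<omega>
    unfolding Y_def using measurable_space[OF iterate_measurable that] by blast
  have "norm ((norm (\<Sum>k=a..<b. Y k \<omega>))\<^sup>2) \<le> (\<Sum>k=a..<b. 2 * B)\<^sup>2" if "\<omega> \<in> space M" for a b \<omega>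
    unfolding real_norm_def abs_power2
    by (rule power_mono[OF sum_norm_le norm_ge_zero]) (rule Ybdd[OF that])
  then show "integrable M (\<lambda>\<omega>. (norm (\<Sum>k=a..<b. Y k \<omega>))\<^sup>2)" for a b
    by (rule integrable_bounded_field[rotated]) measurable
  have Yibdd: "\<bar>Y k \<omega> $ i\<bar> \<le> 2 * B" if "\<omega> \<in> space M" for k i \<omega>
    using Ybdd[OF that, of k] component_le_norm_cart[of "Y k \<omega>" i] by linarith
  have "integrable M (\<lambda>\<omega>. (\<Sum>k=a..<a + n. Y k \<omega> $ i)\<^sup>2)" for i
  proof (rule integrable_bounded_field)
    fix \<omega> assume "\<omega> \<in> space M"
    then have "\<bar>\<Sum>k=a..<a + n. Y k \<omega> $ i\<bar> \<le> (\<Sum>k=a..<a + n. 2 * B)"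
      using Yibdd by (intro order_trans[OF sum_abs] sum_mono) auto
    then have "\<bar>\<Sum>k=a..<a + n. Y k \<omega> $ i\<bar>\<^sup>2 \<le> (\<Sum>k=a..<a + n. 2 * B)\<^sup>2"
      by (intro power_mono) auto
    then show "norm ((\<Sum>k=a..<a + n. Y k \<omega> $ i)\<^sup>2) \<le> (\<Sum>k=a..<a + n. 2 * B)\<^sup>2"
      by simp
  qed measurable
  then have "expectation (\<lambda>\<omega>. (norm (\<Sum>k=a..<a + n. Y k \<omega>))\<^sup>2)
      = (\<Sum>i\<in>UNIV. expectation (\<lambda>\<omega>. (\<Sum>k=a..<a + n. Y k \<omega> $ i)\<^sup>2))"
    unfolding norm_sq_eq_sum_component_sq sum_component by (rule Bochner_Integration.integral_sum)
  also have "\<dots> \<le> (\<Sum>i\<in>(UNIV :: 'd set). 2 * C * real n)"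
  proof (rule sum_mono)
    fix i :: 'd
    show "expectation (\<lambda>\<omega>. (\<Sum>k=a..<a + n. Y k \<omega> $ i)\<^sup>2) \<le> 2 * C * real n"
    proof (rule second_moment_sum_le[OF Yicmeas Yibdd _ c_nonneg c_sum])
      fix k l :: nat assume "k \<le> l"
      then show "expectation (\<lambda>\<omega>. Y k \<omega> $ i * Y l \<omega> $ i) \<le> c i (l - k)"
        unfolding Y_def using corr by (simp add: correlation_shift[OF cmeas_i cmeas_i])
    qed
  qed
  finally show "expectation (\<lambda>\<omega>. (norm (\<Sum>k=a..<a + n. Y k \<omega>))\<^sup>2) \<le> 2 * C * real CARD('d) * real n"
    by (simp add: mult_ac)
qed

lemma summable_correlation_bound:
  fixes \<phi> :: "'i \<Rightarrow> int \<Rightarrow> ennreal"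
  assumes "(SUP i. \<Sum>\<^sub>\<infinity>k\<in>UNIV. \<phi> i k) < \<top>"
  obtains C where "0 \<le> C" "\<And>i k. \<phi> i k < \<top>" "\<And>i n. (\<Sum>j<n. enn2real (\<phi> i (int j))) \<le> C"
proof
  let ?S = "SUP i. \<Sum>\<^sub>\<infinity>k\<in>UNIV. \<phi> i k"
  have part: "sum (\<phi> i) K \<le> ?S" if "finite K" for i K
  proof -
    have "sum (\<phi> i) K \<le> (\<Sum>\<^sub>\<infinity>k\<in>UNIV. \<phi> i k)"
      using that by (subst nonneg_infsum_complete) (auto intro: SUP_upper)
    then show ?thesis by (rule order_trans) (auto intro: SUP_upper)
  qed
  show "0 \<le> enn2real ?S" by simp
  show fin: "\<phi> i k < \<top>" for i k
    using part[of "{k}" i] assms by (auto intro: le_less_trans)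
  show "(\<Sum>j<n. enn2real (\<phi> i (int j))) \<le> enn2real ?S" for i n
  proof -
    have "(\<Sum>j<n. enn2real (\<phi> i (int j))) = enn2real (\<Sum>j<n. \<phi> i (int j))"
      by (induction n) (simp_all add: enn2real_plus fin)
    also have "(\<Sum>j<n. \<phi> i (int j)) = sum (\<phi> i) (int ` {..<n})"
      by (simp add: sum.reindex)
    also have "enn2real \<dots> \<le> enn2real ?S"
      using part assms by (intro enn2real_mono) auto
    finally show ?thesis .
  qed
qed

section \<open>The averaging principle\<close>

text \<open>
  The nonnegative integral is monotone on arbitrary functions, so the integrable majorant \<open>h\<close> controls
  a supremum \<open>f\<close> over uncountably many times, whose measurability is left open.
\<close>

lemma L2_norm_le:
  assumes "\<And>\<omega>. \<omega> \<in> space M \<Longrightarrow> (f \<omega>)\<^sup>2 \<le> ennreal (h \<omega>)"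
    and "integrable M h" "\<And>\<omega>. 0 \<le> h \<omega>" "integral\<^sup>L M h \<le> b\<^sup>2" "0 \<le> b"
  shows "L2_norm M f \<le> ennreal b"
proof -
  let ?I = "\<integral>\<^sup>+ \<omega>. (f \<omega>)\<^sup>2 \<partial>M"
  have "?I \<le> (\<integral>\<^sup>+ \<omega>. ennreal (h \<omega>) \<partial>M)"
    using assms(1) by (intro nn_integral_mono)
  also have "\<dots> = ennreal (integral\<^sup>L M h)"
    using assms by (intro nn_integral_eq_integral) auto
  also have "\<dots> \<le> ennreal (b\<^sup>2)"
    using assms by (intro ennreal_leI)
  finally have I: "?I \<le> ennreal (b\<^sup>2)" .
  then have "enn2real ?I \<le> b\<^sup>2"
    using enn2real_mono[OF I] by simp
  then have "sqrt (enn2real ?I) \<le> b"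
    using \<open>0 \<le> b\<close> by (intro real_le_lsqrt) auto
  moreover have "?I \<noteq> \<top>" using I by (auto simp: top_unique)
  ultimately show ?thesis
    by (simp add: L2_norm_def ennreal_leI)
qed

text \<open>
  Rounding \<open>log 2 (T / \<epsilon>)\<close> up to an integer costs at most a factor two in \<open>2 ^ r\<close>. Once \<open>\<bar>ln \<epsilon>\<bar>\<close>
  exceeds \<open>\<bar>ln T\<bar> + 1\<close>, the level \<open>r\<close> is at most \<open>2 * (\<bar>ln T\<bar> + \<bar>ln \<epsilon>\<bar>) + 1\<close>, whence the constant \<open>4\<close>.
\<close>

lemma dyadic_scale_exists:
  assumes "0 < T"
  shows "\<forall>\<^sub>F \<epsilon> in at_right (0::real). 0 < \<epsilon> \<and> \<epsilon> \<le> (ln \<epsilon>)\<^sup>2 \<and>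
    (\<exists>r. T \<le> \<epsilon> * 2 ^ r \<and> \<epsilon> * 2 ^ r \<le> 2 * T \<and> real r + 1 \<le> 4 * \<bar>ln \<epsilon>\<bar>)"
proof -
  define \<delta> where "\<delta> = min T (exp (- (\<bar>ln T\<bar> + 1)))"
  have "0 < \<delta>" using assms by (simp add: \<delta>_def)
  have "0 < \<epsilon> \<and> \<epsilon> \<le> (ln \<epsilon>)\<^sup>2 \<and>
    (\<exists>r. T \<le> \<epsilon> * 2 ^ r \<and> \<epsilon> * 2 ^ r \<le> 2 * T \<and> real r + 1 \<le> 4 * \<bar>ln \<epsilon>\<bar>)"
    if \<epsilon>: "0 < \<epsilon>" "\<epsilon> < \<delta>" for \<epsilon> :: real
  proof -
    have "\<epsilon> < exp (- (\<bar>ln T\<bar> + 1))" and "\<epsilon> < T" using \<epsilon> by (auto simp: \<delta>_def)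
    then have ln_\<epsilon>: "\<bar>ln T\<bar> + 1 < - ln \<epsilon>"
      using \<epsilon>(1) ln_less_cancel_iff[of \<epsilon> "exp (- (\<bar>ln T\<bar> + 1))"] by simp
    then have "1 \<le> (- ln \<epsilon>)\<^sup>2" by (intro one_le_power) auto
    moreover have "\<epsilon> \<le> 1" using ln_\<epsilon> \<epsilon>(1) by (smt (verit) ln_ge_zero)
    ultimately have one: "\<epsilon> \<le> (ln \<epsilon>)\<^sup>2" by simp
    define u where "u = log 2 (T / \<epsilon>)"
    define r where "r = nat \<lceil>u\<rceil>"
    have ratio: "1 < T / \<epsilon>" using \<epsilon>(1) \<open>\<epsilon> < T\<close> by simp
    then have "0 \<le> u" by (simp add: u_def)
    then have r: "u \<le> real r" "real r < u + 1" unfolding r_def by linarith+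
    have pow_u: "2 powr u = T / \<epsilon>" using ratio by (simp add: u_def)
    have "T / \<epsilon> \<le> 2 ^ r"
      using r(1) pow_u powr_mono[of u "real r" 2] by (simp add: powr_realpow)
    moreover have "2 ^ r \<le> 2 * (T / \<epsilon>)"
      using r(2) pow_u powr_mono[of "real r" "u + 1" 2] by (simp add: powr_realpow powr_add mult.commute)
    moreover have "real r + 1 \<le> 4 * \<bar>ln \<epsilon>\<bar>"
    proof -
      have "0 \<le> ln (T / \<epsilon>)" using ratio by simp
      then have "u \<le> ln (T / \<epsilon>) / (1 / 2)"
        unfolding u_def log_def using ln2_ge_two_thirds by (intro divide_left_mono) auto
      also have "\<dots> = 2 * (ln T - ln \<epsilon>)" using assms \<epsilon>(1) by (simp add: ln_div)
      finally have "u \<le> 2 * \<bar>ln T\<bar> - 2 * ln \<epsilon>" by simp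
      then show ?thesis using r(2) ln_\<epsilon> by linarith
    qed
    ultimately show ?thesis using \<epsilon>(1) one
      by (intro conjI exI[of _ r]) (auto simp: field_simps)
  qed
  then show ?thesis
    using eventually_at_right_real[OF \<open>0 < \<delta>\<close>] by (auto elim!: eventually_mono)
qed

theorem theoremA1p2:
  fixes M :: "'w measure" and T :: "'w \<Rightarrow> 'w" and N0 N1 :: "'w set"
    and F :: "real ^ 'd \<Rightarrow> 'w \<Rightarrow> real ^ 'd"
    and X :: "real \<Rightarrow> real ^ 'd \<Rightarrow> 'w \<Rightarrow> real \<Rightarrow> real ^ 'd"
    and w :: "real ^ 'd \<Rightarrow> real \<Rightarrow> real ^ 'd"
    and T0 :: real
  assumes pds: "invertible_pds M T N0 N1"
    and F_measurable: "(\<lambda>(x, \<omega>). F x \<omega>) \<in> borel_measurable (borel \<Otimes>\<^sub>M M)"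
    and F_bounded: "\<exists>B. \<forall>x. \<forall>\<omega>\<in>space M. norm (F x \<omega>) \<le> B"
    and F_lipschitz: "\<exists>L. \<forall>\<omega>\<in>space M. L-lipschitz_on UNIV (\<lambda>x. F x \<omega>)"
    and X_solution: "\<And>\<epsilon> x \<omega>. \<epsilon> > 0 \<Longrightarrow> \<omega> \<in> space M \<Longrightarrow>
           perturbed_solution T F \<epsilon> x \<omega> (X \<epsilon> x \<omega>)"
    and w_solution: "\<And>x. averaged_solution (mean_field M F) x (w x)"
    and T0_pos: "T0 > 0"
    and correlations: "(SUP i. \<Sum>\<^sub>\<infinity>k\<in>(UNIV :: int set). SUP x. SUP y.
           ennreal \<bar>\<integral>\<omega>. centred_field M F x \<omega> $ i
                      * centred_field M F y (pds_iter M T N0 N1 k \<omega>) $ i \<partial>M\<bar>) < \<top>"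
  shows "\<exists>C>0. \<forall>\<^sub>F \<epsilon> in at_right 0.
           (SUP x. L2_norm M (\<lambda>\<omega>. SUP t\<in>{0..T0}. ennreal (infnorm (X \<epsilon> x \<omega> t - w x t))))
             \<le> ennreal (C * (\<bar>ln \<epsilon>\<bar> * sqrt \<epsilon>))"
proof -
  interpret invertible_pds M T N0 N1 by (rule pds)
  obtain B where B: "\<And>x \<omega>. \<omega> \<in> space M \<Longrightarrow> norm (F x \<omega>) \<le> B"
    using F_bounded by blast
  obtain L where lip: "\<And>\<omega>. \<omega> \<in> space M \<Longrightarrow> L-lipschitz_on UNIV (\<lambda>x. F x \<omega>)"
    using F_lipschitz by blast
  obtain \<omega>0 where \<omega>0: "\<omega>0 \<in> space M" using not_empty by blast
  have B0: "0 \<le> B" by (rule order_trans[OF norm_ge_zero B[OF \<omega>0, of 0]])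
  have L0: "0 \<le> L" by (rule lipschitz_on_nonneg[OF lip[OF \<omega>0]])
  have Fmeas: "F x \<in> borel_measurable M" for x
    using measurable_compose[OF measurable_Pair1'[of x borel M] F_measurable] by simp
  have Fint: "integrable M (F x)" for x
    using Fmeas B by (rule integrable_bounded_field)
  have lip_mean: "L-lipschitz_on UNIV (mean_field M F)"
    using Fint lip by (rule mean_field_lipschitz)
  have bdd_mean: "norm (mean_field M F x) \<le> B" for x
    unfolding mean_field_def using Fint B by (rule norm_mean_le)

  define \<kappa> where "\<kappa> i k x y = (\<integral>\<omega>. centred_field M F x \<omega> $ i
      * centred_field M F y (pds_iter M T N0 N1 k \<omega>) $ i \<partial>M)" for i k x y
  define \<phi> where "\<phi> i k = (SUP x. SUP y. ennreal \<bar>\<kappa> i k x y\<bar>)" for i k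
  have "(SUP i. \<Sum>\<^sub>\<infinity>k\<in>UNIV. \<phi> i k) < \<top>"
    using correlations unfolding \<phi>_def \<kappa>_def .
  then obtain C where C: "0 \<le> C" and \<phi>_fin: "\<And>i k. \<phi> i k < \<top>"
    and c_sum: "\<And>i n. (\<Sum>j<n. enn2real (\<phi> i (int j))) \<le> C"
    by (rule summable_correlation_bound) blast
  \<comment> \<open>Conversion to real numbers sends infinity to zero; finiteness of \<open>\<phi>\<close> is what makes
    its real values upper bounds.\<close>
  have corr: "(\<integral>\<omega>. centred_field M F x \<omega> $ i * centred_field M F y ((T ^^ j) \<omega>) $ i \<partial>M)
      \<le> enn2real (\<phi> i (int j))" for i j x y
  proof -
    have "ennreal \<bar>\<kappa> i (int j) x y\<bar> \<le> \<phi> i (int j)"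
      unfolding \<phi>_def by (rule SUP_upper2[where i=x]) (auto intro: SUP_upper)
    then have "\<bar>\<kappa> i (int j) x y\<bar> \<le> enn2real (\<phi> i (int j))"
      using enn2real_mono[OF _ \<phi>_fin] by fastforce
    then show ?thesis by (simp add: \<kappa>_def pds_iter_def)
  qed

  define K where "K = 2 * C * real CARD('d)"
  define A where "A = exp (L * T0) * (1 + 2 * L * B * T0) + 2 * B"
  define D where "D = A * sqrt (2 * (32 * T0 * K + 1))"
  have K0: "0 \<le> K" using C by (simp add: K_def)
  have A0: "0 < A"
    using L0 B0 T0_pos by (auto simp: A_def intro!: add_pos_nonneg mult_pos_pos)
  have D0: "0 < D"
    using A0 K0 T0_pos by (auto simp: D_def intro!: mult_pos_pos add_nonneg_pos)

  have bound: "L2_norm M (\<lambda>\<omega>. SUP t\<in>{0..T0}. ennreal (infnorm (X \<epsilon> x \<omega> t - w x t)))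
      \<le> ennreal (D * (\<bar>ln \<epsilon>\<bar> * sqrt \<epsilon>))"
    if \<epsilon>: "0 < \<epsilon>" "\<epsilon> \<le> (ln \<epsilon>)\<^sup>2"
      and r: "T0 \<le> \<epsilon> * 2 ^ r" "\<epsilon> * 2 ^ r \<le> 2 * T0" "real r + 1 \<le> 4 * \<bar>ln \<epsilon>\<bar>"
    for \<epsilon> x r
  proof -
    define Y where "Y k \<omega> = centred_field M F (w x (\<epsilon> * real k)) ((T ^^ k) \<omega>)" for k \<omega>
    define Q where "Q \<omega> = dyadic_energy (\<lambda>k. Y k \<omega>) 0 r" for \<omega>
    define R where "R \<omega> = (real r + 1) * Q \<omega>" for \<omega>
    define h where "h \<omega> = 2 * (A * \<epsilon>)\<^sup>2 * (R \<omega> + 1)" for \<omega>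
    note moments = noise_second_moment_le[of F B "\<lambda>i j. enn2real (\<phi> i (int j))" C
        "\<lambda>k. w x (\<epsilon> * real k)", OF Fmeas B corr enn2real_nonneg c_sum, folded Y_def K_def]
    have Q: "integrable M Q" "expectation Q \<le> (real r + 1) * 2 ^ r * K"
      using integral_dyadic_energy_le[OF moments, of 0 r] by (simp_all add: Q_def[abs_def])
    have R0: "0 \<le> R \<omega>" for \<omega>
      by (simp add: R_def Q_def dyadic_energy_nonneg)
    have dw: "(w x has_vector_derivative mean_field M F (w x t)) (at t within {0..})" if "0 \<le> t" for t
      using w_solution[of x] that by (simp add: averaged_solution_def)

    \<comment> \<open>The Gronwall constant, the Euler error and the oscillation inside one cell are all absorbed
      into \<open>A\<close>, so that only \<open>\<epsilon>\<close> times one plus the maximal noise sum remains.\<close>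
    have pathwise: "norm (X \<epsilon> x \<omega> t - w x t) \<le> A * \<epsilon> * (sqrt (R \<omega>) + 1)"
      if \<omega>: "\<omega> \<in> space M" and t: "0 \<le> t" "t \<le> T0" for \<omega> t
    proof -
      have orbit: "(T ^^ k) \<omega> \<in> space M" for k
        using measurable_space[OF iterate_measurable \<omega>] .
      have sol: "perturbed_solution T F \<epsilon> x \<omega> (X \<epsilon> x \<omega>)"
        by (rule X_solution[OF \<epsilon>(1) \<omega>])
      have "norm (X \<epsilon> x \<omega> t - w x t)
          \<le> exp (L * T0) * (\<epsilon> * sqrt (R \<omega>) + 2 * L * B * T0 * \<epsilon>) + 2 * B * \<epsilon>"
      proof (rule averaging_error_le[where f="\<lambda>k z. F z ((T ^^ k) \<omega>)" and g="mean_field M F"])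
        show "continuous_on {0..} (X \<epsilon> x \<omega>)"
          using sol by (simp add: perturbed_solution_def)
        show "(X \<epsilon> x \<omega> has_vector_derivative F (X \<epsilon> x \<omega> s) ((T ^^ k) \<omega>)) (at s)"
          if s: "\<epsilon> * real k < s" "s < \<epsilon> * real (Suc k)" for k s
        proof -
          have floor: "\<lfloor>s / \<epsilon>\<rfloor> = int k"
            using s \<epsilon>(1) by (intro floor_unique) (auto simp: field_simps)
          have "s \<noteq> \<epsilon> * of_int j" for j
          proof
            assume j: "s = \<epsilon> * of_int j"
            then have "j = int k" using floor \<epsilon>(1) by simp
            with j s(1) show False by simp
          qed
          moreover have "0 \<le> s"
            using s(1) \<epsilon>(1) by (intro order_trans[OF _ less_imp_le[OF s(1)]]) simp
          ultimately show ?thesis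
            using sol floor unfolding perturbed_solution_def by fastforce
        qed
        show "continuous_on {0..} (w x)"
          using dw by (auto simp: continuous_on_eq_continuous_within intro: has_vector_derivative_continuous)
        show "(w x has_vector_derivative mean_field M F (w x s)) (at s)" if "0 < s" for s
          using dw[of s] that at_within_interior[of s "{0..}"] by simp
        show "X \<epsilon> x \<omega> 0 = w x 0"
          using sol w_solution[of x] by (simp add: perturbed_solution_def averaged_solution_def)
        show "norm (\<Sum>k<m. F (w x (\<epsilon> * real k)) ((T ^^ k) \<omega>) - mean_field M F (w x (\<epsilon> * real k)))
            \<le> sqrt (R \<omega>)" if m: "\<epsilon> * real m \<le> T0" for m
        proof -
          have "\<epsilon> * real m \<le> \<epsilon> * 2 ^ r" using m r(1) by linarith
          then have "real m \<le> 2 ^ r" using \<epsilon>(1) by simp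
          then have "m \<le> 2 ^ r" by simp
          then have "(norm (\<Sum>k<m. Y k \<omega>))\<^sup>2 \<le> R \<omega>"
            using partial_sum_le_dyadic_energy[of m r "\<lambda>k. Y k \<omega>" 0]
            by (simp add: R_def Q_def lessThan_atLeast0)
          then show ?thesis by (simp add: Y_def centred_field_def real_le_rsqrt)
        qed
      qed (rule \<epsilon>(1) lip[OF orbit] lip_mean B[OF orbit] bdd_mean t)+
      also have "\<dots> \<le> A * \<epsilon> * (sqrt (R \<omega>) + 1)"
      proof -
        define s where "s = sqrt (R \<omega>)"
        define E where "E = exp (L * T0)"
        have "0 \<le> \<epsilon> * (E * (2 * L * B * T0) * s + E + 2 * B * s)"
          using \<epsilon>(1) L0 B0 T0_pos R0 by (auto simp: s_def E_def intro!: mult_nonneg_nonneg add_nonneg_nonneg)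
        also have "\<dots> = A * \<epsilon> * (s + 1) - (E * (\<epsilon> * s + 2 * L * B * T0 * \<epsilon>) + 2 * B * \<epsilon>)"
          unfolding A_def E_def[symmetric] by (simp add: algebra_simps)
        finally show ?thesis by (simp add: s_def E_def)
      qed
      finally show ?thesis .
    qed

    show ?thesis
    proof (rule L2_norm_le)
      show "(SUP t\<in>{0..T0}. ennreal (infnorm (X \<epsilon> x \<omega> t - w x t)))\<^sup>2 \<le> ennreal (h \<omega>)"
        if \<omega>: "\<omega> \<in> space M" for \<omega>
      proof -
        let ?b = "A * \<epsilon> * (sqrt (R \<omega>) + 1)"
        have b0: "0 \<le> ?b" using A0 \<epsilon>(1) R0 by simp
        have "(SUP t\<in>{0..T0}. ennreal (infnorm (X \<epsilon> x \<omega> t - w x t))) \<le> ennreal ?b"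
          using pathwise[OF \<omega>] by (intro SUP_least ennreal_leI order_trans[OF infnorm_le_norm]) auto
        then have "(SUP t\<in>{0..T0}. ennreal (infnorm (X \<epsilon> x \<omega> t - w x t)))\<^sup>2 \<le> (ennreal ?b)\<^sup>2"
          by (intro power_mono) auto
        also have "\<dots> = ennreal (?b\<^sup>2)" using b0 by (rule ennreal_power)
        also have "?b\<^sup>2 \<le> h \<omega>"
        proof -
          have "(s + 1)\<^sup>2 \<le> 2 * (s\<^sup>2 + 1)" for s :: real
            using zero_le_power2[of "s - 1"] by (simp add: power2_eq_square algebra_simps)
          from mult_left_mono[OF this[of "sqrt (R \<omega>)"], of "(A * \<epsilon>)\<^sup>2"]
          have "(A * \<epsilon>)\<^sup>2 * (sqrt (R \<omega>) + 1)\<^sup>2 \<le> (A * \<epsilon>)\<^sup>2 * (2 * (R \<omega> + 1))"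
            using R0 by simp
          moreover have "h \<omega> = (A * \<epsilon>)\<^sup>2 * (2 * (R \<omega> + 1))"
            by (simp only: h_def mult_ac)
          ultimately show ?thesis by (simp only: power_mult_distrib)
        qed
        finally show ?thesis by (simp add: ennreal_leI)
      qed
      show "integrable M h"
        unfolding h_def[abs_def] R_def using Q(1) by (intro integrable_mult_right Bochner_Integration.integrable_add) auto
      show "0 \<le> h \<omega>" for \<omega> using R0 by (simp add: h_def)
      show "0 \<le> D * (\<bar>ln \<epsilon>\<bar> * sqrt \<epsilon>)" using D0 \<epsilon>(1) by simp
      show "integral\<^sup>L M h \<le> (D * (\<bar>ln \<epsilon>\<bar> * sqrt \<epsilon>))\<^sup>2"
      proof -
        have "integral\<^sup>L M h = 2 * (A * \<epsilon>)\<^sup>2 * ((real r + 1) * expectation Q + 1)"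
          unfolding h_def[abs_def] R_def using Q(1) by (simp add: prob_space)
        also have "\<dots> \<le> 2 * (A * \<epsilon>)\<^sup>2 * ((real r + 1) * ((real r + 1) * 2 ^ r * K) + 1)"
          using Q(2) by (intro mult_left_mono add_right_mono) auto
        also have "\<dots> = 2 * A\<^sup>2 * \<epsilon> * ((real r + 1)\<^sup>2 * ((\<epsilon> * 2 ^ r) * K) + \<epsilon>)"
          by (simp add: power2_eq_square algebra_simps)
        \<comment> \<open>Here \<open>\<epsilon> * 2 ^ r\<close> is of order \<open>T0\<close> and \<open>r\<close> of order \<open>\<bar>ln \<epsilon>\<bar>\<close>. The last summand is the squared
          discretisation error, of lower order than the noise.\<close>
        also have "\<dots> \<le> 2 * A\<^sup>2 * \<epsilon> * ((4 * \<bar>ln \<epsilon>\<bar>)\<^sup>2 * ((2 * T0) * K) + (ln \<epsilon>)\<^sup>2)"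
        proof (intro mult_left_mono add_mono \<epsilon>(2))
          have "(real r + 1)\<^sup>2 \<le> (4 * \<bar>ln \<epsilon>\<bar>)\<^sup>2"
            using r(3) by (intro power_mono) auto
          then show "(real r + 1)\<^sup>2 * ((\<epsilon> * 2 ^ r) * K) \<le> (4 * \<bar>ln \<epsilon>\<bar>)\<^sup>2 * ((2 * T0) * K)"
            using \<epsilon>(1) K0 by (intro mult_mono[OF _ mult_right_mono[OF r(2)]]) auto
        qed (use \<epsilon>(1) in auto)
        also have "\<dots> = A\<^sup>2 * (2 * (32 * T0 * K + 1)) * ((ln \<epsilon>)\<^sup>2 * \<epsilon>)"
          by (simp add: power_mult_distrib algebra_simps)
        also have "\<dots> = (D * (\<bar>ln \<epsilon>\<bar> * sqrt \<epsilon>))\<^sup>2"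
          using \<epsilon>(1) K0 T0_pos by (simp add: D_def power_mult_distrib)
        finally show ?thesis .
      qed
    qed
  qed
  show ?thesis
  proof (intro exI[of _ D] conjI D0)
    show "\<forall>\<^sub>F \<epsilon> in at_right 0.
        (SUP x. L2_norm M (\<lambda>\<omega>. SUP t\<in>{0..T0}. ennreal (infnorm (X \<epsilon> x \<omega> t - w x t))))
          \<le> ennreal (D * (\<bar>ln \<epsilon>\<bar> * sqrt \<epsilon>))"
    proof (rule eventually_mono[OF dyadic_scale_exists[OF T0_pos]], elim conjE exE)
      fix \<epsilon> :: real and r :: nat
      assume "0 < \<epsilon>" "\<epsilon> \<le> (ln \<epsilon>)\<^sup>2" "T0 \<le> \<epsilon> * 2 ^ r" "\<epsilon> * 2 ^ r \<le> 2 * T0"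
        "real r + 1 \<le> 4 * \<bar>ln \<epsilon>\<bar>"
      then show "(SUP x. L2_norm M (\<lambda>\<omega>. SUP t\<in>{0..T0}. ennreal (infnorm (X \<epsilon> x \<omega> t - w x t))))
          \<le> ennreal (D * (\<bar>ln \<epsilon>\<bar> * sqrt \<epsilon>))"
        by (intro SUP_least bound)
    qed
  qed
qed

end
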